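(* Let $\Phi=(G,\varphi)$ be a complex unit gain graph of order $n$ whose underlying graph $G$ has at least one edge. Then $$1-\theta(G)\leq\frac{r(\Phi)}{r(G)}\leq1+\theta(G).$$ Moreover: (a) equality holds in the upper bound if and only if either $\Phi$ is acyclic, or $\Phi$ consists of one gain cycle $C_4^{\varphi}$ of Type B together with some isolated vertices; (b) equality holds in the lower bound if and only if $\Phi$ is acyclic.
   Context: A complex unit gain graph $\Phi=(G,\varphi)$ consists of a finite simple graph $G$ (the underlying graph) with vertex set $\{v_1,\dots,v_n\}$ and a gain function $\varphi$ assigning to each oriented edge $e_{ij}$ (from $v_i$ to $v_j$, where $v_iv_j\in E(G)$) a complex number of modulus $1$, with $\varphi(e_{ji})=\overline{\varphi(e_{ij})}$. The adjacency matrix $A(\Phi)$ is the Hermitian matrix with $(i,j)$ entry $\varphi(e_{ij})$ if $v_iv_j\in E(G)$ and $0$ otherwise; $r(\Phi)$ is its rank, and $r(G)$ is the rank of the $0$-$1$ adjacency matrix of $G$. $\theta(G)=|E(G)|-|V(G)|+\omega(G)$, where $\omega(G)$ is the number of connected components of $G$. $\Phi$ is acyclic if $G$ has no cycle. For a gain cycle $C_n^{\varphi}$ with vertices $v_1,\dots,v_n$ in cyclic order, $\varphi(C_n)=\varphi(e_{12})\varphi(e_{23})\cdots\varphi(e_{n-1,n})\varphi(e_{n1})$; for $n$ even, $C_n^\varphi$ is of Type A if $\varphi(C_n)=(-1)^{n/2}$ and of Type B if $\varphi(C_n)\neq(-1)^{n/2}$. *)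

theory Defs
  imports Complex_Main "Jordan_Normal_Form.DL_Rank"
begin

definition simple_graph :: "nat \<Rightarrow> (nat \<Rightarrow> nat \<Rightarrow> bool) \<Rightarrow> bool" where
  "simple_graph n E \<longleftrightarrow>
     (\<forall>i j. E i j \<longrightarrow> i < n \<and> j < n) \<and>
     (\<forall>i j. E i j \<longrightarrow> E j i) \<and>
     (\<forall>i. \<not> E i i)"

definition unit_gain :: "(nat \<Rightarrow> nat \<Rightarrow> bool) \<Rightarrow> (nat \<Rightarrow> nat \<Rightarrow> complex) \<Rightarrow> bool" where
  "unit_gain E \<phi> \<longleftrightarrow>
     (\<forall>i j. E i j \<longrightarrow> cmod (\<phi> i j) = 1 \<and> \<phi> j i = cnj (\<phi> i j))"

definition gain_adj :: "nat \<Rightarrow> (nat \<Rightarrow> nat \<Rightarrow> bool) \<Rightarrow> (nat \<Rightarrow> nat \<Rightarrow> complex) \<Rightarrow> complex mat" where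
  "gain_adj n E \<phi> = mat n n (\<lambda>(i, j). if E i j then \<phi> i j else 0)"

definition graph_adj :: "nat \<Rightarrow> (nat \<Rightarrow> nat \<Rightarrow> bool) \<Rightarrow> real mat" where
  "graph_adj n E = mat n n (\<lambda>(i, j). if E i j then 1 else 0)"

definition gain_rank :: "nat \<Rightarrow> (nat \<Rightarrow> nat \<Rightarrow> bool) \<Rightarrow> (nat \<Rightarrow> nat \<Rightarrow> complex) \<Rightarrow> nat" where
  "gain_rank n E \<phi> = vec_space.rank n (gain_adj n E \<phi>)"

definition graph_rank :: "nat \<Rightarrow> (nat \<Rightarrow> nat \<Rightarrow> bool) \<Rightarrow> nat" where
  "graph_rank n E = vec_space.rank n (graph_adj n E)"

definition num_edges :: "nat \<Rightarrow> (nat \<Rightarrow> nat \<Rightarrow> bool) \<Rightarrow> nat" where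
  "num_edges n E = card {(i, j). i < j \<and> j < n \<and> E i j}"

definition num_components :: "nat \<Rightarrow> (nat \<Rightarrow> nat \<Rightarrow> bool) \<Rightarrow> nat" where
  "num_components n E =
     card ({0..<n} // {(i, j). i < n \<and> j < n \<and> (i, j) \<in> {(a, b). E a b}\<^sup>*})"

definition theta :: "nat \<Rightarrow> (nat \<Rightarrow> nat \<Rightarrow> bool) \<Rightarrow> int" where
  "theta n E = int (num_edges n E) - int n + int (num_components n E)"

definition is_cycle :: "(nat \<Rightarrow> nat \<Rightarrow> bool) \<Rightarrow> nat list \<Rightarrow> bool" where
  "is_cycle E vs \<longleftrightarrow> length vs \<ge> 3 \<and> distinct vs \<and>
     (\<forall>k < length vs. E (vs ! k) (vs ! ((k + 1) mod length vs)))"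

definition acyclic_graph :: "(nat \<Rightarrow> nat \<Rightarrow> bool) \<Rightarrow> bool" where
  "acyclic_graph E \<longleftrightarrow> \<not> (\<exists>vs. is_cycle E vs)"

definition cycle_gain :: "(nat \<Rightarrow> nat \<Rightarrow> complex) \<Rightarrow> nat list \<Rightarrow> complex" where
  "cycle_gain \<phi> vs = (\<Prod>k < length vs. \<phi> (vs ! k) (vs ! ((k + 1) mod length vs)))"

definition typeB :: "(nat \<Rightarrow> nat \<Rightarrow> complex) \<Rightarrow> nat list \<Rightarrow> bool" where
  "typeB \<phi> vs \<longleftrightarrow> even (length vs) \<and> cycle_gain \<phi> vs \<noteq> (-1) ^ (length vs div 2)"

definition C4_typeB_plus_isolated ::
  "(nat \<Rightarrow> nat \<Rightarrow> bool) \<Rightarrow> (nat \<Rightarrow> nat \<Rightarrow> complex) \<Rightarrow> bool" where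
  "C4_typeB_plus_isolated E \<phi> \<longleftrightarrow>
     (\<exists>vs. length vs = 4 \<and> is_cycle E vs \<and> typeB \<phi> vs \<and>
        (\<forall>x y. E x y \<longleftrightarrow>
           (\<exists>k < 4. {x, y} = {vs ! k, vs ! ((k + 1) mod 4)})))"

end

theory Submission
  imports Defs
begin

text \<open>
  Switching along a spanning forest (conjugation by a unitary diagonal matrix) turns every gain on
  the forest into 1. The switched gain matrix and the 0-1 adjacency matrix then differ only on the
  remaining \<open>\<theta>\<close> edges, so their ranks differ by at most \<open>2\<theta>\<close>. As the rank of a graph with an
  edge is at least 2, both bounds follow, and for \<open>\<theta> > 0\<close> equality forces \<open>r(G) = 2\<close>. In the lower
  bound this would give \<open>r(\<Phi>) \<le> 0\<close>. In the upper bound, \<open>G\<close> is a complete bipartite graph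
  with parts of sizes \<open>p, q\<close> together with isolated vertices, so \<open>\<theta> = (p - 1)(q - 1)\<close>, while
  covering the edges by one part gives \<open>2 + 2\<theta> = r(\<Phi>) \<le> 2 min(p, q)\<close>; hence \<open>p = q = 2\<close>.
\<close>

section \<open>Matrix rank\<close>

text \<open>Each index \<open>l\<close> contributes a matrix of rank at most 1, and rank is
  subadditive. Together with the next lemma this characterises rank by entrywise factorizations,
  which can be moved between dimensions and fields.\<close>

lemma (in vec_space) rank_le_card_of_sum_products:
  fixes f :: "nat \<Rightarrow> 'l \<Rightarrow> 'a" and g :: "'l \<Rightarrow> nat \<Rightarrow> 'a"
  assumes "finite L" and "A \<in> carrier_mat n nc"
    and "\<And>i j. i < n \<Longrightarrow> j < nc \<Longrightarrow> A $$ (i, j) = (\<Sum>l\<in>L. f i l * g l j)"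
  shows "rank A \<le> card L"
  using assms
proof (induction L arbitrary: A rule: finite_induct)
  case empty
  then have "A = 0\<^sub>m n nc" by (intro eq_matI) auto
  then show ?case by (simp add: rank_0I)
next
  case (insert x L)
  define B where "B = mat n nc (\<lambda>(i, j). f i x * g x j)"
  define C where "C = mat n nc (\<lambda>(i, j). \<Sum>l\<in>L. f i l * g l j)"
  have carr: "B \<in> carrier_mat n nc" "C \<in> carrier_mat n nc"
    by (simp_all add: B_def C_def)
  have "A = B + C"
    using insert by (intro eq_matI) (auto simp: B_def C_def)
  moreover have "rank B \<le> 1"
    by (rule rank_le_1_product_entries[OF carr(1), of "\<lambda>i. f i x" "g x"]) (auto simp: B_def)
  moreover have "rank C \<le> card L"
    by (rule insert.IH[OF carr(2)]) (auto simp: C_def)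
  ultimately show ?case
    using rank_subadditive[OF carr] insert.hyps by simp
qed

text \<open>A maximal independent set of columns spans all columns and has \<open>rank A\<close>
  elements. Since the left factor consists of columns of \<open>A\<close> itself, it inherits
  properties of \<open>A\<close>, such as having real entries.\<close>

lemma (in vec_space) rank_column_factorization:
  assumes A: "A \<in> carrier_mat n nc"
  obtains S g where "S \<subseteq> {0..<nc}" "card S = rank A"
    "\<And>i j. i < n \<Longrightarrow> j < nc \<Longrightarrow> A $$ (i, j) = (\<Sum>l\<in>S. A $$ (i, l) * g l j)"
proof -
  have carr: "set (cols A) \<subseteq> carrier_vec n" using cols_dim A by blast
  have "lin_indpt {}"
    by (metis (no_types) empty_subsetI fin_dim finite_basis_exists subset_li_is_li vec_vs vectorspace.basis_def)
  then obtain U where U: "finite U" "maximal U (\<lambda>T. T \<subseteq> set (cols A) \<and> lin_indpt T)"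
    using maximal_exists_superset[of "set (cols A)" "\<lambda>T. T \<subseteq> set (cols A) \<and> lin_indpt T" "{}"]
    by auto
  then have Us: "U \<subseteq> set (cols A)" and Ui: "lin_indpt U" by (auto simp: maximal_def)
  have Uc: "U \<subseteq> carrier_vec n" using Us carr by blast
  have spanU: "s \<in> span U" if s: "s \<in> set (cols A)" for s
  proof (rule ccontr)
    assume ns: "s \<notin> span U"
    then have nU: "s \<notin> U" using Uc span_mem by auto
    have "lin_indpt (U \<union> {s})"
      using lin_dep_iff_in_span[OF Uc Ui _ nU] ns s carr by auto
    then show False
      using U(2) nU Us s unfolding maximal_def by blast
  qed
  have "\<exists>l<nc. u = col A l" if "u \<in> U" for u
    using that Us A by (fastforce simp: cols_def)
  \<comment> \<open>\<open>U\<close> contains vectors, and equal columns may sit at several indices;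
    \<open>c\<close> picks one index per vector. It is injective because \<open>col A (c u)\<close>
    gives back \<open>u\<close>.\<close>
  then obtain c where c: "\<And>u. u \<in> U \<Longrightarrow> c u < nc \<and> u = col A (c u)" by metis
  have inj: "inj_on c U" using c by (metis inj_onI)
  have "\<exists>a. \<forall>i<n. A $$ (i, j) = (\<Sum>l\<in>c ` U. A $$ (i, l) * a l)" if j: "j < nc" for j
  proof -
    have "col A j \<in> span U" by (rule spanU) (use j A in \<open>auto simp: cols_def\<close>)
    then obtain a B where B: "col A j = lincomb a B" "finite B" "B \<subseteq> U"
      using in_spanE by blast
    define b where "b = (\<lambda>l. if col A l \<in> B then a (col A l) else 0)"
    have "A $$ (i, j) = (\<Sum>l\<in>c ` U. A $$ (i, l) * b l)" if i: "i < n" for i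
    proof -
      have "A $$ (i, j) = col A j $ i" using i j A by simp
      also have "\<dots> = (\<Sum>x\<in>B. a x * x $ i)"
        unfolding B(1) by (rule lincomb_index[OF i]) (use B Uc in auto)
      also have "\<dots> = (\<Sum>x\<in>U. (if x \<in> B then a x else 0) * x $ i)"
        by (rule sum.mono_neutral_cong_left) (use U B in auto)
      also have "\<dots> = (\<Sum>x\<in>U. A $$ (i, c x) * b (c x))"
      proof (rule sum.cong[OF refl])
        fix x assume "x \<in> U"
        then have x: "c x < nc" "col A (c x) = x" using c[of x] by auto
        then have "x $ i = A $$ (i, c x)" using i A by (metis carrier_matD index_col)
        then show "(if x \<in> B then a x else 0) * x $ i = A $$ (i, c x) * b (c x)"
          using x by (simp add: b_def)
      qed
      also have "\<dots> = (\<Sum>l\<in>c ` U. A $$ (i, l) * b l)"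
        using inj by (simp add: sum.reindex)
      finally show ?thesis .
    qed
    then show ?thesis by blast
  qed
  then obtain g where g: "\<And>j. j < nc \<Longrightarrow> \<forall>i<n. A $$ (i, j) = (\<Sum>l\<in>c ` U. A $$ (i, l) * g j l)"
    by metis
  show thesis
  proof (rule that[of "c ` U" "\<lambda>l j. g j l"])
    show "c ` U \<subseteq> {0..<nc}" using c by auto
    show "card (c ` U) = rank A"
      using rank_card_indpt[OF A U(2)] card_image[OF inj] by simp
  qed (use g in blast)
qed

text \<open>A factorization of \<open>A\<close> restricts along \<open>r\<close> and
  \<open>c\<close> to a factorization of \<open>B\<close> with no more terms, while a nonsingular
  \<open>B\<close> has full rank \<open>k\<close>.\<close>

lemma rank_ge_of_nonsingular_submatrix:
  fixes A :: "'a::field mat"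
  assumes A: "A \<in> carrier_mat n nc" and B: "B \<in> carrier_mat k k" and "det B \<noteq> 0"
    and idx: "\<And>i. i < k \<Longrightarrow> r i < n" "\<And>j. j < k \<Longrightarrow> c j < nc"
    and ent: "\<And>i j. i < k \<Longrightarrow> j < k \<Longrightarrow> B $$ (i, j) = A $$ (r i, c j)"
  shows "k \<le> vec_space.rank n A"
proof -
  obtain S g where S: "S \<subseteq> {0..<nc}" "card S = vec_space.rank n A"
    and fac: "\<And>i j. i < n \<Longrightarrow> j < nc \<Longrightarrow> A $$ (i, j) = (\<Sum>l\<in>S. A $$ (i, l) * g l j)"
    using vec_space.rank_column_factorization[OF A] by blast
  have "vec_space.rank k B \<le> card S"
    by (rule vec_space.rank_le_card_of_sum_products[OF finite_subset[OF S(1)] B,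
          of "\<lambda>i l. A $$ (r i, l)" "\<lambda>l j. g l (c j)"])
      (use ent idx fac in auto)
  moreover have "vec_space.rank k B = k"
    using vec_space.low_rank_det_zero[OF B \<open>det B \<noteq> 0\<close>] .
  ultimately show ?thesis using S by simp
qed

text \<open>Split off the rows in \<open>T\<close>; what remains is supported on the columns in
  \<open>T\<close>. Either summand is a sum of \<open>card T\<close> products, one factor being an
  indicator.\<close>

lemma rank_le_of_vertex_cover:
  fixes A :: "'a::field mat"
  assumes A: "A \<in> carrier_mat n n" and T: "finite T"
    and cov: "\<And>i j. i < n \<Longrightarrow> j < n \<Longrightarrow> i \<notin> T \<Longrightarrow> j \<notin> T \<Longrightarrow> A $$ (i, j) = 0"
  shows "vec_space.rank n A \<le> 2 * card T"
proof -
  define B where "B = mat n n (\<lambda>(i, j). if i \<in> T then A $$ (i, j) else 0)"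
  define C where "C = mat n n (\<lambda>(i, j). if i \<in> T then 0 else A $$ (i, j))"
  have carr: "B \<in> carrier_mat n n" "C \<in> carrier_mat n n"
    by (simp_all add: B_def C_def)
  have "A = B + C"
    using A by (intro eq_matI) (auto simp: B_def C_def)
  moreover have "vec_space.rank n B \<le> card T"
    by (rule vec_space.rank_le_card_of_sum_products[OF T carr(1),
          of "\<lambda>i t. if i = t then 1 else 0" "\<lambda>t j. A $$ (t, j)"])
      (use T in \<open>auto simp: B_def if_distrib[of "\<lambda>x. x * _"] cong: if_cong\<close>)
  moreover have "vec_space.rank n C \<le> card T"
    by (rule vec_space.rank_le_card_of_sum_products[OF T carr(2),
          of "\<lambda>i t. if i \<in> T then 0 else A $$ (i, t)" "\<lambda>t j. if j = t then 1 else 0"])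
      (use T cov in \<open>auto simp: C_def if_distrib[of "\<lambda>x. _ * x"] cong: if_cong\<close>)
  ultimately show ?thesis
    using vec_space.rank_subadditive[OF carr] by simp
qed

text \<open>Diagonal scaling of rows and columns does not raise the rank of \<open>B\<close>, and
  the error \<open>A - C\<close> is supported on rows and columns in \<open>T\<close>, so each
  element of \<open>T\<close> costs at most 2. Switching enters the rank estimates through this
  lemma.\<close>

lemma rank_le_of_scaling_off_cover:
  fixes A B :: "'a::field mat"
  assumes A: "A \<in> carrier_mat n n" and B: "B \<in> carrier_mat n n" and T: "finite T"
    and eq: "\<And>i j. i < n \<Longrightarrow> j < n \<Longrightarrow> i \<notin> T \<Longrightarrow> j \<notin> T \<Longrightarrow> A $$ (i, j) = a i * B $$ (i, j) * b j"
  shows "vec_space.rank n A \<le> vec_space.rank n B + 2 * card T"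
proof -
  define C where "C = mat n n (\<lambda>(i, j). a i * B $$ (i, j) * b j)"
  have C: "C \<in> carrier_mat n n" and AC: "A - C \<in> carrier_mat n n"
    using A by (auto simp: C_def)
  obtain S g where S: "S \<subseteq> {0..<n}" "card S = vec_space.rank n B"
    and fac: "\<And>i j. i < n \<Longrightarrow> j < n \<Longrightarrow> B $$ (i, j) = (\<Sum>l\<in>S. B $$ (i, l) * g l j)"
    using vec_space.rank_column_factorization[OF B] by blast
  have "vec_space.rank n C \<le> card S"
  proof (rule vec_space.rank_le_card_of_sum_products[OF finite_subset[OF S(1)] C])
    fix i j assume ij: "i < n" "j < n"
    then have "C $$ (i, j) = a i * (\<Sum>l\<in>S. B $$ (i, l) * g l j) * b j"
      by (simp add: C_def fac[symmetric])
    then show "C $$ (i, j) = (\<Sum>l\<in>S. (a i * B $$ (i, l)) * (g l j * b j))"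
      by (simp add: sum_distrib_left sum_distrib_right mult_ac)
  qed simp
  moreover have "vec_space.rank n (A - C) \<le> 2 * card T"
    by (rule rank_le_of_vertex_cover[OF AC T]) (use A C eq in \<open>auto simp: C_def\<close>)
  moreover have "A = C + (A - C)"
    using A C by (intro eq_matI) auto
  ultimately show ?thesis
    using vec_space.rank_subadditive[OF C AC] S by simp
qed

lemma rank_map_mat_complex_of_real:
  fixes A :: "real mat"
  assumes A: "A \<in> carrier_mat n nc"
  shows "vec_space.rank n (map_mat complex_of_real A) = vec_space.rank n A"
proof (rule antisym)
  have CA: "map_mat complex_of_real A \<in> carrier_mat n nc" using A by simp
  obtain S g where S: "S \<subseteq> {0..<nc}" "card S = vec_space.rank n A"
    and fac: "\<And>i j. i < n \<Longrightarrow> j < nc \<Longrightarrow> A $$ (i, j) = (\<Sum>l\<in>S. A $$ (i, l) * g l j)"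
    using vec_space.rank_column_factorization[OF A] by blast
  have "vec_space.rank n (map_mat complex_of_real A) \<le> card S"
  proof (rule vec_space.rank_le_card_of_sum_products[OF finite_subset[OF S(1)] CA])
    fix i j assume ij: "i < n" "j < nc"
    then have "map_mat complex_of_real A $$ (i, j) = complex_of_real (\<Sum>l\<in>S. A $$ (i, l) * g l j)"
      using A by (simp add: fac[symmetric])
    then show "map_mat complex_of_real A $$ (i, j) =
        (\<Sum>l\<in>S. complex_of_real (A $$ (i, l)) * complex_of_real (g l j))"
      by simp
  qed simp
  then show "vec_space.rank n (map_mat complex_of_real A) \<le> vec_space.rank n A" using S by simp
  obtain S g where S: "S \<subseteq> {0..<nc}" "card S = vec_space.rank n (map_mat complex_of_real A)"
    and fac: "\<And>i j. i < n \<Longrightarrow> j < nc \<Longrightarrow> map_mat complex_of_real A $$ (i, j) =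
          (\<Sum>l\<in>S. map_mat complex_of_real A $$ (i, l) * g l j)"
    using vec_space.rank_column_factorization[OF CA] by blast
  have "vec_space.rank n A \<le> card S"
  proof (rule vec_space.rank_le_card_of_sum_products[OF finite_subset[OF S(1)] A])
    fix i j assume ij: "i < n" "j < nc"
    have "complex_of_real (A $$ (i, j)) = (\<Sum>l\<in>S. complex_of_real (A $$ (i, l)) * g l j)"
      using fac[OF ij] ij A S by (auto simp: subset_iff intro!: sum.cong)
    \<comment> \<open>The columns used are real, so only the coefficients are complex, and taking
      real parts leaves a real factorization with the same index set.\<close>
    then have "Re (complex_of_real (A $$ (i, j))) = Re (\<Sum>l\<in>S. complex_of_real (A $$ (i, l)) * g l j)"
      by simp
    then show "A $$ (i, j) = (\<Sum>l\<in>S. A $$ (i, l) * Re (g l j))"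
      by simp
  qed simp
  then show "vec_space.rank n A \<le> vec_space.rank n (map_mat complex_of_real A)" using S by simp
qed

section \<open>Cyclomatic number and switching\<close>

abbreviation graph_reach :: "(nat \<Rightarrow> nat \<Rightarrow> bool) \<Rightarrow> (nat \<times> nat) set" where
  "graph_reach E \<equiv> {(a, b). E a b}\<^sup>*"

definition del_edge :: "(nat \<Rightarrow> nat \<Rightarrow> bool) \<Rightarrow> nat \<Rightarrow> nat \<Rightarrow> nat \<Rightarrow> nat \<Rightarrow> bool" where
  "del_edge E u v x y \<longleftrightarrow> E x y \<and> {x, y} \<noteq> {u, v}"

section \<open>Edge deletion, components and \<open>theta\<close>\<close>

lemma simple_graphD:
  assumes "simple_graph n E"
  shows "E i j \<Longrightarrow> i < n" "E i j \<Longrightarrow> j < n" "E i j \<Longrightarrow> E j i" "\<not> E i i"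
  using assms by (auto simp: simple_graph_def)

lemma graph_reach_sym:
  assumes "simple_graph n E" and "(x, y) \<in> graph_reach E"
  shows "(y, x) \<in> graph_reach E"
proof -
  have "sym {(a, b). E a b}" using simple_graphD(3)[OF assms(1)] by (auto simp: sym_def)
  then show ?thesis using assms(2) by (meson sym_rtrancl symD)
qed

lemma graph_reach_less:
  assumes "simple_graph n E" and "(x, y) \<in> graph_reach E" and "x < n"
  shows "y < n"
  using assms(2,3) by (induction rule: rtrancl_induct) (auto dest: simple_graphD(2)[OF assms(1)])

text \<open>Edges never leave \<open>{0..<n}\<close>, so restricting reachability to vertices below
  \<open>n\<close> does not shrink the class of such a vertex.\<close>

lemma num_components_eq_card_reach_classes:
  assumes "simple_graph n E"
  shows "num_components n E = card ((\<lambda>i. {j. (i, j) \<in> graph_reach E}) ` {0..<n})"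
proof -
  have "{0..<n} // {(i, j). i < n \<and> j < n \<and> (i, j) \<in> graph_reach E}
      = (\<lambda>i. {j. (i, j) \<in> graph_reach E}) ` {0..<n}"
    unfolding quotient_def UNION_singleton_eq_range
    by (rule image_cong[OF refl]) (auto dest: graph_reach_less[OF assms])
  then show ?thesis unfolding num_components_def by simp
qed

lemma simple_graph_del_edge:
  "simple_graph n E \<Longrightarrow> simple_graph n (del_edge E u v)"
  by (auto simp: simple_graph_def del_edge_def insert_commute)

text \<open>Restoring the edge merges the classes of \<open>u\<close> and \<open>v\<close> and
  affects no other class. In the proof \<open>rtrancl_insert\<close> is used once for each
  orientation of the edge.\<close>

lemma graph_reach_del_edge:
  assumes G: "simple_graph n E" and uv: "E u v"
  shows "(x, y) \<in> graph_reach E \<longleftrightarrow> (x, y) \<in> graph_reach (del_edge E u v) \<or>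
    (((u, x) \<in> graph_reach (del_edge E u v) \<or> (v, x) \<in> graph_reach (del_edge E u v)) \<and>
     ((u, y) \<in> graph_reach (del_edge E u v) \<or> (v, y) \<in> graph_reach (del_edge E u v)))"
proof -
  let ?R = "graph_reach (del_edge E u v)"
  have eq: "{(a, b). E a b} = insert (u, v) (insert (v, u) {(a, b). del_edge E u v a b})"
    using uv simple_graphD(3)[OF G uv] by (auto simp: del_edge_def doubleton_eq_iff)
  have sym: "(a, b) \<in> ?R \<longleftrightarrow> (b, a) \<in> ?R" for a b
    using graph_reach_sym[OF simple_graph_del_edge[OF G]] by blast
  have trans: "(a, b) \<in> ?R \<Longrightarrow> (b, c) \<in> ?R \<Longrightarrow> (a, c) \<in> ?R" for a b c by auto
  show ?thesis
    unfolding eq rtrancl_insert using sym trans by auto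
qed

lemma num_edges_del_edge:
  assumes G: "simple_graph n E" and uv: "E u v"
  shows "num_edges n E = Suc (num_edges n (del_edge E u v))"
proof -
  let ?F = "{(i, j). i < j \<and> j < n \<and> del_edge E u v i j}"
  have ne: "u \<noteq> v" using uv simple_graphD(4)[OF G] by auto
  have "{(i, j). i < j \<and> j < n \<and> E i j} = insert (min u v, max u v) ?F"
    using ne uv simple_graphD[OF G] by (auto simp: del_edge_def doubleton_eq_iff min_def max_def)
  moreover have "finite ?F"
    by (rule finite_subset[of _ "{0..<n} \<times> {0..<n}"]) auto
  moreover have "(min u v, max u v) \<notin> ?F"
    by (auto simp: del_edge_def min_def max_def insert_commute)
  ultimately show ?thesis by (simp add: num_edges_def)
qed

text \<open>Deletion lowers the edge count by one. For a bridge the number of components grows by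
  one and compensates; otherwise the components stay the same and \<open>theta\<close>
  drops.\<close>

lemma theta_del_edge:
  assumes G: "simple_graph n E" and uv: "E u v"
  shows "theta n E = theta n (del_edge E u v) +
    (if (u, v) \<in> graph_reach (del_edge E u v) then 1 else 0)"
proof -
  let ?E = "del_edge E u v"
  let ?R = "graph_reach ?E"
  define K where "K = (\<lambda>i. {j. (i, j) \<in> ?R})"
  define K' where "K' = (\<lambda>i. {j. (i, j) \<in> graph_reach E})"
  have sym: "(a, b) \<in> ?R \<longleftrightarrow> (b, a) \<in> ?R" for a b
    using graph_reach_sym[OF simple_graph_del_edge[OF G]] by blast
  have trans: "(a, b) \<in> ?R \<Longrightarrow> (b, c) \<in> ?R \<Longrightarrow> (a, c) \<in> ?R" for a b c by auto
  have Keq: "K x = K y \<longleftrightarrow> (x, y) \<in> ?R" for x y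
    unfolding K_def using sym trans by blast
  have mem: "x \<in> K y \<longleftrightarrow> K x = K y" for x y
    unfolding Keq using sym[of x y] by (simp add: K_def)
  have c: "num_components n ?E = card (K ` {0..<n})"
    using num_components_eq_card_reach_classes[OF simple_graph_del_edge[OF G]] by (simp add: K_def)
  have c': "num_components n E = card (K' ` {0..<n})"
    using num_components_eq_card_reach_classes[OF G] by (simp add: K'_def)
  have lt: "u < n" "v < n" using simple_graphD[OF G] uv by auto
  show ?thesis
  proof (cases "(u, v) \<in> ?R")
    case True
    then have "K' = K"
      unfolding K_def K'_def graph_reach_del_edge[OF G uv] using sym trans by blast
    then show ?thesis
      using True c c' num_edges_del_edge[OF G uv] by (simp add: theta_def)
  next
    case False
    let ?C = "K u \<union> K v"
    have K': "K' x = (if x \<in> ?C then ?C else K x)" for x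
      unfolding K_def K'_def graph_reach_del_edge[OF G uv] using sym trans by auto
    have inC: "x \<in> ?C \<longleftrightarrow> K x = K u \<or> K x = K v" for x
      by (simp add: mem)
    \<comment> \<open>The old classes \<open>K u\<close> and \<open>K v\<close> are replaced by
      their union; all others survive unchanged.\<close>
    have "K' ` {0..<n} = insert ?C (K ` {0..<n} - {K u, K v})"
    proof (intro equalityI subsetI)
      fix S assume "S \<in> K' ` {0..<n}"
      then obtain x where "x \<in> {0..<n}" "S = K' x" by blast
      then show "S \<in> insert ?C (K ` {0..<n} - {K u, K v})"
        using K'[of x] inC[of x] by (cases "x \<in> ?C") auto
    next
      fix S assume S: "S \<in> insert ?C (K ` {0..<n} - {K u, K v})"
      show "S \<in> K' ` {0..<n}"
      proof (cases "S = ?C")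
        case True
        then have "S = K' u" using K'[of u] inC[of u] by simp
        then show ?thesis using lt by simp
      next
        case False
        then obtain x where x: "x \<in> {0..<n}" "S = K x" "K x \<noteq> K u" "K x \<noteq> K v" using S by blast
        then have "S = K' x" using K'[of x] inC[of x] by simp
        then show ?thesis using x by blast
      qed
    qed
    moreover have "?C \<notin> K ` {0..<n} - {K u, K v}"
    proof
      assume "?C \<in> K ` {0..<n} - {K u, K v}"
      then obtain x where x: "?C = K x" "K x \<noteq> K u" "K x \<noteq> K v" by auto
      have "x \<in> K x" by (simp add: K_def)
      then show False using x inC by auto
    qed
    moreover have "card (K ` {0..<n} - {K u, K v}) = card (K ` {0..<n}) - 2"
      using lt False by (subst card_Diff_subset) (auto simp: Keq)
    \<comment> \<open>Since \<open>K u\<close> and \<open>K v\<close> differ, there are at least two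
      classes, so the subtraction of 2 on naturals is exact.\<close>
    moreover have "card {K u, K v} \<le> card (K ` {0..<n})"
      using lt by (intro card_mono) auto
    ultimately have "num_components n ?E = Suc (num_components n E)"
      using c c' False by (simp add: Keq)
    then show ?thesis
      using False num_edges_del_edge[OF G uv] by (simp add: theta_def)
  qed
qed

lemma simple_graph_edge_induct [consumes 1, case_names empty edge]:
  assumes "simple_graph n E"
    and empty: "P (\<lambda>_ _. False)"
    and edge: "\<And>E u v. simple_graph n E \<Longrightarrow> E u v \<Longrightarrow> P (del_edge E u v) \<Longrightarrow> P E"
  shows "P E"
  using assms(1)
proof (induction "num_edges n E" arbitrary: E rule: less_induct)
  case less
  show ?case
  proof (cases "\<exists>u v. E u v")
    case True
    then obtain u v where uv: "E u v" by blast
    show ?thesis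
      by (rule edge[OF less.prems uv], rule less.hyps)
        (use num_edges_del_edge[OF less.prems uv] simple_graph_del_edge[OF less.prems] in auto)
  next
    case False
    then have "E = (\<lambda>_ _. False)" by auto
    then show ?thesis using empty by simp
  qed
qed

lemma theta_empty: "theta n (\<lambda>_ _. False) = 0"
proof -
  have "num_components n (\<lambda>_ _. False) = card ((\<lambda>i. {i}) ` {0..<n})"
    by (subst num_components_eq_card_reach_classes) (auto simp: simple_graph_def intro!: arg_cong[of _ _ card])
  also have "\<dots> = n" by (subst card_image) auto
  finally show ?thesis by (simp add: theta_def num_edges_def)
qed

section \<open>Paths, cycles and bridges\<close>

lemma distinct_path_of_rtrancl:
  assumes "(u, v) \<in> r\<^sup>*"
  obtains xs where "xs \<noteq> []" "hd xs = u" "last xs = v" "distinct xs"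
    "successively (\<lambda>a b. (a, b) \<in> r) xs"
proof -
  have "\<exists>xs. xs \<noteq> [] \<and> hd xs = u \<and> last xs = v \<and> distinct xs \<and> successively (\<lambda>a b. (a, b) \<in> r) xs"
    using assms
  proof (induction rule: converse_rtrancl_induct)
    case base
    show ?case by (rule exI[of _ "[v]"]) auto
  next
    case (step y z)
    then obtain xs where xs: "xs \<noteq> []" "hd xs = z" "last xs = v" "distinct xs"
      "successively (\<lambda>a b. (a, b) \<in> r) xs" by blast
    show ?case
    proof (cases "y \<in> set xs")
      \<comment> \<open>The new start \<open>y\<close> already lies on the path: everything before
        its occurrence is cut away, so that no vertex repeats.\<close>
      case True
      then obtain ys zs where "xs = ys @ y # zs" by (meson split_list)
      then show ?thesis using xs
        by (intro exI[of _ "y # zs"]) (auto simp: successively_append_iff)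
    next
      case False
      then show ?thesis using xs step.hyps(1)
        by (intro exI[of _ "y # xs"]) (auto simp: successively_Cons)
    qed
  qed
  then show thesis using that by blast
qed

text \<open>A simple path from \<open>u\<close> to \<open>v\<close> that avoids the edge
  \<open>uv\<close> is closed to a cycle by that edge.\<close>

lemma cycle_of_reachable_del_edge:
  assumes G: "simple_graph n E" and uv: "E u v" and R: "(u, v) \<in> graph_reach (del_edge E u v)"
  shows "\<not> acyclic_graph E"
proof -
  obtain xs where xs: "xs \<noteq> []" "hd xs = u" "last xs = v" "distinct xs"
    "successively (\<lambda>a b. (a, b) \<in> {(a, b). del_edge E u v a b}) xs"
    using distinct_path_of_rtrancl[OF R] .
  have step: "del_edge E u v (xs ! k) (xs ! Suc k)" if "Suc k < length xs" for k
    using xs(5) that by (simp add: successively_conv_nth)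
  have h: "xs ! 0 = u" and l: "xs ! (length xs - 1) = v"
    using xs by (simp_all add: hd_conv_nth last_conv_nth)
  have "u \<noteq> v" using uv simple_graphD(4)[OF G] by auto
  \<comment> \<open>One vertex would mean \<open>u = v\<close>, and two would mean that the path
    uses the deleted edge; hence the length of at least 3 that a cycle requires.\<close>
  then have "length xs \<noteq> 1" using h l by auto
  moreover have "length xs \<noteq> 2" using step[of 0] h l by (auto simp: del_edge_def)
  moreover have "length xs \<noteq> 0" using xs by simp
  ultimately have len: "length xs \<ge> 3" by linarith
  have "E (xs ! k) (xs ! ((k + 1) mod length xs))" if k: "k < length xs" for k
  proof (cases "Suc k = length xs")
    case True
    then have "xs ! k = v" using l by (metis diff_Suc_1)
    then show ?thesis using True h simple_graphD(3)[OF G uv] by simp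
  next
    case False
    then show ?thesis using step[of k] k by (simp add: del_edge_def)
  qed
  then have "is_cycle E xs" using len xs by (simp add: is_cycle_def)
  then show ?thesis by (auto simp: acyclic_graph_def)
qed

text \<open>Two steps return to the start only if \<open>L\<close> divides 2. This ensures that
  different positions of a cycle carry different unordered edges.\<close>

lemma cycle_next_neq:
  fixes k L :: nat
  assumes "3 \<le> L" "k < L"
  shows "((k + 1) mod L + 1) mod L \<noteq> k"
proof
  assume "((k + 1) mod L + 1) mod L = k"
  then have "(k + 2) mod L = k mod L" using assms by (simp add: mod_simps)
  then have "L dvd 2"
    using mod_eq_dvd_iff_nat[of k "k + 2" L] by simp
  then show False using assms(1) by (auto dest: dvd_imp_le)
qed

text \<open>If a cycle passed through the bridge, its remaining edges would still join the ends of
  the bridge.\<close>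

lemma acyclic_graph_del_edge_bridge:
  assumes G: "simple_graph n E" and uv: "E u v" and R: "(u, v) \<notin> graph_reach (del_edge E u v)"
  shows "acyclic_graph (del_edge E u v) \<longleftrightarrow> acyclic_graph E"
proof
  assume "acyclic_graph E"
  then show "acyclic_graph (del_edge E u v)"
    by (auto simp: acyclic_graph_def is_cycle_def del_edge_def)
next
  assume ac: "acyclic_graph (del_edge E u v)"
  let ?R = "graph_reach (del_edge E u v)"
  show "acyclic_graph E"
    unfolding acyclic_graph_def
  proof
    assume "\<exists>vs. is_cycle E vs"
    then obtain vs where vs: "is_cycle E vs" ..
    let ?L = "length vs"
    have L: "?L \<ge> 3" and d: "distinct vs"
      and e: "\<And>k. k < ?L \<Longrightarrow> E (vs ! k) (vs ! ((k + 1) mod ?L))"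
      using vs by (auto simp: is_cycle_def)
    have "\<not> is_cycle (del_edge E u v) vs" using ac by (auto simp: acyclic_graph_def)
    then obtain k where k: "k < ?L" "{vs ! k, vs ! ((k + 1) mod ?L)} = {u, v}"
      using L d e by (auto simp: is_cycle_def del_edge_def)
    \<comment> \<open>The cycle uses the bridge at position \<open>k\<close> only: by distinctness a
      second occurrence would run in the opposite direction, so two steps forward from
      \<open>k\<close> would lead back to \<open>k\<close>.\<close>
    have other: "del_edge E u v (vs ! a) (vs ! ((a + 1) mod ?L))" if a: "a < ?L" "a \<noteq> k" for a
    proof -
      have lt: "(a + 1) mod ?L < ?L" "(k + 1) mod ?L < ?L" using L by (auto intro!: mod_less_divisor)
      have "{vs ! a, vs ! ((a + 1) mod ?L)} \<noteq> {vs ! k, vs ! ((k + 1) mod ?L)}"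
      proof
        assume "{vs ! a, vs ! ((a + 1) mod ?L)} = {vs ! k, vs ! ((k + 1) mod ?L)}"
        then have "a = (k + 1) mod ?L" "(a + 1) mod ?L = k"
          using a k(1) lt d by (auto simp: doubleton_eq_iff nth_eq_iff_index_eq)
        then show False using cycle_next_neq[OF L k(1)] by simp
      qed
      then show ?thesis using e[OF a(1)] k(2) by (simp add: del_edge_def)
    qed
    \<comment> \<open>Walk around the cycle, starting just after the bridge; for
      \<open>m < ?L\<close> the walk has not yet crossed position \<open>k\<close> again.\<close>
    have walk: "(vs ! ((k + 1) mod ?L), vs ! ((k + 1 + m) mod ?L)) \<in> ?R" if "m < ?L" for m
      using that
    proof (induction m)
      case 0
      show ?case by simp
    next
      case (Suc m)
      let ?a = "(k + 1 + m) mod ?L"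
      have lt: "?a < ?L" using L by (auto intro!: mod_less_divisor)
      have "?a \<noteq> k"
      proof
        assume "?a = k"
        then have "(k + (m + 1)) mod ?L = k mod ?L" using k(1) by (simp add: add_ac)
        then have "?L dvd m + 1" using mod_eq_dvd_iff_nat[of k "k + (m + 1)" ?L] by simp
        then show False using Suc.prems by (auto dest: dvd_imp_le)
      qed
      then have "del_edge E u v (vs ! ?a) (vs ! ((?a + 1) mod ?L))" using other lt by simp
      moreover have "(?a + 1) mod ?L = (k + 1 + Suc m) mod ?L" by (simp add: mod_simps)
      ultimately have "(vs ! ?a, vs ! ((k + 1 + Suc m) mod ?L)) \<in> {(a, b). del_edge E u v a b}" by simp
      then show ?case using Suc by (meson Suc_lessD rtrancl.rtrancl_into_rtrancl)
    qed
    have wrap: "(k + 1 + (?L - 1)) mod ?L = k"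
    proof -
      have "k + 1 + (?L - 1) = k + ?L" using L by simp
      then show ?thesis using k(1) by simp
    qed
    have "?L - 1 < ?L" using L by simp
    from walk[OF this] have "(vs ! ((k + 1) mod ?L), vs ! k) \<in> ?R"
      unfolding wrap .
    then have "(u, v) \<in> ?R \<or> (v, u) \<in> ?R" using k(2) by (auto simp: doubleton_eq_iff)
    then show False
      using R graph_reach_sym[OF simple_graph_del_edge[OF G]] by blast
  qed
qed

text \<open>Induction on edges: deleting a bridge preserves both \<open>theta\<close> and
  acyclicity, while an edge that is no bridge makes \<open>theta\<close> positive and lies on a
  cycle.\<close>

lemma theta_nonneg_and_zero_iff_acyclic:
  assumes "simple_graph n E"
  shows "theta n E \<ge> 0 \<and> (theta n E = 0 \<longleftrightarrow> acyclic_graph E)"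
  using assms
proof (induction rule: simple_graph_edge_induct)
  case empty
  have "\<not> is_cycle (\<lambda>_ _. False) vs" for vs by (cases vs) (auto simp: is_cycle_def)
  then show ?case by (auto simp: theta_empty acyclic_graph_def)
next
  case (edge E u v)
  then show ?case
    using theta_del_edge[OF edge(1,2)] acyclic_graph_del_edge_bridge[OF edge(1,2)]
      cycle_of_reachable_del_edge[OF edge(1,2)]
    by (cases "(u, v) \<in> graph_reach (del_edge E u v)") auto
qed

text \<open>Here \<open>d\<close> is the switching function and \<open>T\<close> collects one end of
  each edge outside a spanning forest. Edges are restored one by one: an edge closing a cycle puts
  an end into \<open>T\<close> and is paid for by the growth of \<open>theta\<close>; a bridge is
  absorbed by rescaling \<open>d\<close> on one side.\<close>

lemma switching_off_cover:
  assumes "simple_graph n E" and "unit_gain E \<phi>"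
  shows "\<exists>d T. (\<forall>i. cmod (d i) = 1) \<and> finite T \<and> int (card T) \<le> theta n E \<and>
    (\<forall>i j. E i j \<longrightarrow> i \<in> T \<or> j \<in> T \<or> \<phi> i j = d i * cnj (d j))"
  using assms
proof (induction rule: simple_graph_edge_induct)
  case empty
  show ?case by (rule exI[of _ "\<lambda>_. 1"], rule exI[of _ "{}"]) (simp add: theta_empty)
next
  case (edge E u v)
  let ?E = "del_edge E u v"
  have "unit_gain ?E \<phi>" using edge.prems by (auto simp: unit_gain_def del_edge_def)
  then obtain d T where d: "\<And>i. cmod (d i) = 1" and T: "finite T" "int (card T) \<le> theta n ?E"
    and eq: "\<And>i j. ?E i j \<Longrightarrow> i \<in> T \<or> j \<in> T \<or> \<phi> i j = d i * cnj (d j)"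
    using edge.IH by blast
  show ?case
  proof (cases "(u, v) \<in> graph_reach ?E")
    case True
    have "int (card (insert u T)) \<le> theta n E"
      using T True theta_del_edge[OF edge.hyps] by (auto simp: card_insert_if)
    moreover have "i \<in> insert u T \<or> j \<in> insert u T \<or> \<phi> i j = d i * cnj (d j)" if "E i j" for i j
      using eq[of i j] that by (auto simp: del_edge_def doubleton_eq_iff)
    ultimately show ?thesis using d T(1) by (metis finite_insert)
  next
    case False
    have gain: "cmod (\<phi> u v) = 1" "\<phi> v u = cnj (\<phi> u v)"
      using edge by (auto simp: unit_gain_def)
    \<comment> \<open>The factor \<open>c\<close> solves
      \<open>d u * cnj (c * d v) = \<phi> u v\<close>; it is applied to the whole component of
      \<open>v\<close> in the graph without the bridge.\<close>
    define c where "c = cnj (\<phi> u v) * d u * cnj (d v)"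
    define d' where "d' = (\<lambda>x. if (v, x) \<in> graph_reach ?E then c * d x else d x)"
    have c: "cmod c = 1" using gain d by (simp add: c_def norm_mult)
    have unit: "z * cnj z = 1" if "cmod z = 1" for z
      using that by (simp add: complex_norm_square[symmetric])
    have d'1: "cmod (d' i) = 1" for i using c d by (simp add: d'_def norm_mult)
    have nvu: "(v, u) \<notin> graph_reach ?E"
      using False graph_reach_sym[OF simple_graph_del_edge[OF edge.hyps(1)]] by blast
    have uv: "\<phi> u v = d' u * cnj (d' v)"
    proof -
      have "d' u * cnj (d' v) = \<phi> u v * (d u * cnj (d u)) * (d v * cnj (d v))"
        using nvu by (simp add: d'_def c_def)
      then show ?thesis using unit d by simp
    qed
    have vu: "\<phi> v u = d' v * cnj (d' u)"
      unfolding gain uv by simp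
    have "i \<in> T \<or> j \<in> T \<or> \<phi> i j = d' i * cnj (d' j)" if E: "E i j" for i j
    proof (cases "{i, j} = {u, v}")
      case True
      then show ?thesis using uv vu by (auto simp: doubleton_eq_iff)
    next
      case False
      then have E': "?E i j" using E by (simp add: del_edge_def)
      then have "?E j i" using simple_graphD(3)[OF simple_graph_del_edge[OF edge.hyps(1)]] by blast
      \<comment> \<open>Every other edge has both ends on the same side of the bridge, so
        \<open>c\<close> occurs either not at all or together with its conjugate, which cancels
        it.\<close>
      then have iff: "(v, i) \<in> graph_reach ?E \<longleftrightarrow> (v, j) \<in> graph_reach ?E"
        using E' by (auto intro: rtrancl_into_rtrancl)
      have "d' i * cnj (d' j) = d i * cnj (d j) * (if (v, i) \<in> graph_reach ?E then c * cnj c else 1)"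
        using iff by (simp add: d'_def)
      then have "d' i * cnj (d' j) = d i * cnj (d j)" using unit[OF c] by simp
      then show ?thesis using eq[OF E'] by simp
    qed
    then show ?thesis
      using d'1 T theta_del_edge[OF edge.hyps] False by (intro exI[of _ d'] exI[of _ T]) auto
  qed
qed

text \<open>With parts of sizes \<open>p\<close> and \<open>q\<close> there are \<open>p * q\<close>
  edges, one nontrivial component and \<open>n - p - q\<close> isolated vertices, and
  \<open>p * q - p - q + 1\<close> factors.\<close>

lemma theta_complete_bipartite:
  assumes XY: "X \<subseteq> {0..<n}" "Y \<subseteq> {0..<n}" "X \<inter> Y = {}" "X \<noteq> {}" "Y \<noteq> {}"
    and E: "\<And>x y. E x y \<longleftrightarrow> x \<in> X \<and> y \<in> Y \<or> x \<in> Y \<and> y \<in> X"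
  shows "theta n E = (int (card X) - 1) * (int (card Y) - 1)"
proof -
  have fin: "finite X" "finite Y" using XY by (auto intro: finite_subset)
  have G: "simple_graph n E" using XY by (auto simp: simple_graph_def E)
  \<comment> \<open>\<open>num_edges\<close> counts increasing pairs, so a pair from
    \<open>X \<times> Y\<close> is sorted; disjointness of the parts keeps this injective.\<close>
  have "bij_betw (\<lambda>(x, y). (min x y, max x y)) (X \<times> Y) {(i, j). i < j \<and> j < n \<and> E i j}"
    unfolding bij_betw_def
  proof
    show "inj_on (\<lambda>(x, y). (min x y, max x y)) (X \<times> Y)"
      using XY(3) by (auto simp: inj_on_def min_def max_def split: if_splits)
    show "(\<lambda>(x, y). (min x y, max x y)) ` (X \<times> Y) = {(i, j). i < j \<and> j < n \<and> E i j}"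
    proof (intro equalityI subsetI)
      fix p assume "p \<in> (\<lambda>(x, y). (min x y, max x y)) ` (X \<times> Y)"
      then obtain x y where "x \<in> X" "y \<in> Y" "p = (min x y, max x y)" by auto
      moreover from this have "x \<noteq> y" "x < n" "y < n" using XY by auto
      ultimately show "p \<in> {(i, j). i < j \<and> j < n \<and> E i j}"
        by (auto simp: E min_def max_def)
    next
      fix p assume "p \<in> {(i, j). i < j \<and> j < n \<and> E i j}"
      then obtain i j where p: "p = (i, j)" "i < j" "E i j" by auto
      then consider "i \<in> X" "j \<in> Y" | "j \<in> X" "i \<in> Y" by (auto simp: E)
      then show "p \<in> (\<lambda>(x, y). (min x y, max x y)) ` (X \<times> Y)"
      proof cases
        case 1
        then show ?thesis using p by (intro image_eqI[of _ _ "(i, j)"]) auto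
      next
        case 2
        then show ?thesis using p by (intro image_eqI[of _ _ "(j, i)"]) auto
      qed
    qed
  qed
  then have edges: "num_edges n E = card X * card Y"
    by (simp add: num_edges_def bij_betw_same_card[symmetric] card_cartesian_product)
  obtain x0 y0 where x0: "x0 \<in> X" and y0: "y0 \<in> Y" using XY by auto
  let ?C = "X \<union> Y"
  have toX: "(i, x0) \<in> graph_reach E" if "i \<in> ?C" for i
  proof (cases "i \<in> X")
    case True
    then have "(i, y0) \<in> {(a, b). E a b}" "(y0, x0) \<in> {(a, b). E a b}" using x0 y0 by (auto simp: E)
    then show ?thesis by (meson r_into_rtrancl rtrancl_trans)
  next
    case False
    then have "(i, x0) \<in> {(a, b). E a b}" using that x0 by (auto simp: E)
    then show ?thesis by auto
  qed
  have conn: "(i, j) \<in> graph_reach E" if "i \<in> ?C" "j \<in> ?C" for i j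
    using toX[OF that(1)] graph_reach_sym[OF G toX[OF that(2)]] by (rule rtrancl_trans)
  have inv: "i \<in> ?C \<and> j \<in> ?C \<or> i = j" if "(i, j) \<in> graph_reach E" for i j
    using that by (induction rule: rtrancl_induct) (auto simp: E)
  have cls: "{j. (i, j) \<in> graph_reach E} = (if i \<in> ?C then ?C else {i})" for i
    using conn inv by auto
  have "(\<lambda>i. {j. (i, j) \<in> graph_reach E}) ` {0..<n} = insert ?C ((\<lambda>i. {i}) ` ({0..<n} - ?C))"
    unfolding cls using x0 XY by (auto simp: image_iff split: if_splits)
  moreover have "?C \<notin> (\<lambda>i. {i}) ` ({0..<n} - ?C)" by blast
  moreover have "card ((\<lambda>i. {i}) ` ({0..<n} - ?C)) = n - (card X + card Y)"
    using XY fin by (simp add: card_image card_Diff_subset card_Un_disjoint)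
  ultimately have "num_components n E = Suc (n - (card X + card Y))"
    by (simp add: num_components_eq_card_reach_classes[OF G])
  moreover have "card X + card Y \<le> n"
    using card_mono[of "{0..<n}" ?C] XY fin by (simp add: card_Un_disjoint)
  ultimately show ?thesis
    by (simp add: theta_def edges algebra_simps of_nat_diff)
qed

section \<open>Ranks of gain graphs\<close>

lemma gain_adj_carrier: "gain_adj n E \<phi> \<in> carrier_mat n n"
  by (simp add: gain_adj_def)

lemma graph_adj_carrier: "graph_adj n E \<in> carrier_mat n n"
  by (simp add: graph_adj_def)

lemma rank_bounds_of_switching_off_cover:
  assumes d: "\<And>i. cmod (d i) = 1" and T: "finite T"
    and eq: "\<And>i j. E i j \<Longrightarrow> i \<in> T \<or> j \<in> T \<or> \<phi> i j = d i * cnj (d j)"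
  shows "gain_rank n E \<phi> \<le> graph_rank n E + 2 * card T"
    and "graph_rank n E \<le> gain_rank n E \<phi> + 2 * card T"
proof -
  let ?A = "gain_adj n E \<phi>" and ?B = "map_mat complex_of_real (graph_adj n E)"
  have B: "?B \<in> carrier_mat n n" using graph_adj_carrier by auto
  have rB: "vec_space.rank n ?B = graph_rank n E"
    using rank_map_mat_complex_of_real[OF graph_adj_carrier] by (simp add: graph_rank_def)
  have unit: "cnj (d i) * d i = 1" "d i * cnj (d i) = 1" for i
    using d[of i] by (simp_all add: complex_norm_square[symmetric] mult.commute[of "cnj _"])
  have "vec_space.rank n ?A \<le> vec_space.rank n ?B + 2 * card T"
    by (rule rank_le_of_scaling_off_cover[OF gain_adj_carrier B T, where a = d and b = "\<lambda>j. cnj (d j)"])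
      (auto simp: gain_adj_def graph_adj_def dest: eq)
  then show "gain_rank n E \<phi> \<le> graph_rank n E + 2 * card T"
    unfolding rB by (simp add: gain_rank_def)
  have "cnj (d i) * (d i * cnj (d j)) * d j = 1" for i j
  proof -
    have "cnj (d i) * (d i * cnj (d j)) * d j = (cnj (d i) * d i) * (cnj (d j) * d j)"
      by (simp only: mult_ac)
    then show ?thesis by (simp only: unit mult_1)
  qed
  \<comment> \<open>The switching is undone with conjugates, which are inverses on the unit
    circle.\<close>
  then have "vec_space.rank n ?B \<le> vec_space.rank n ?A + 2 * card T"
    by (intro rank_le_of_scaling_off_cover[OF B gain_adj_carrier T, where a = "\<lambda>i. cnj (d i)" and b = d])
      (auto simp: gain_adj_def graph_adj_def dest!: eq)
  then show "graph_rank n E \<le> gain_rank n E \<phi> + 2 * card T"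
    unfolding rB by (simp add: gain_rank_def)
qed

lemma rank_difference_le_theta:
  assumes "simple_graph n E" and "unit_gain E \<phi>"
  shows "int (gain_rank n E \<phi>) \<le> int (graph_rank n E) + 2 * theta n E"
    and "int (graph_rank n E) \<le> int (gain_rank n E \<phi>) + 2 * theta n E"
proof -
  obtain d T where dT: "\<forall>i. cmod (d i) = 1" "finite T" "int (card T) \<le> theta n E"
    "\<forall>i j. E i j \<longrightarrow> i \<in> T \<or> j \<in> T \<or> \<phi> i j = d i * cnj (d j)"
    using switching_off_cover[OF assms] by blast
  from rank_bounds_of_switching_off_cover[of d T E \<phi> n] dT
  show "int (gain_rank n E \<phi>) \<le> int (graph_rank n E) + 2 * theta n E"
    and "int (graph_rank n E) \<le> int (gain_rank n E \<phi>) + 2 * theta n E"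
    by fastforce+
qed

section \<open>Small ranks\<close>

lemma graph_rank_ge_2:
  assumes G: "simple_graph n E" and ab: "E a b"
  shows "graph_rank n E \<ge> 2"
proof (rule ccontr)
  assume "\<not> graph_rank n E \<ge> 2"
  moreover obtain S g where S: "S \<subseteq> {0..<n}" "card S = graph_rank n E"
    and fac: "\<And>i j. i < n \<Longrightarrow> j < n \<Longrightarrow>
      graph_adj n E $$ (i, j) = (\<Sum>l\<in>S. graph_adj n E $$ (i, l) * g l j)"
    using vec_space.rank_column_factorization[OF graph_adj_carrier] unfolding graph_rank_def by blast
  moreover have "finite S" using S(1) finite_subset by blast
  ultimately consider "S = {}" | p where "S = {p}"
    by (metis One_nat_def card_1_singletonE card_0_eq less_2_cases linorder_not_le)
  then show False
  proof cases
    case 1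
    then show ?thesis using fac[of a b] ab simple_graphD(1-3)[OF G ab] by (simp add: graph_adj_def)
  next
    case 2
    \<comment> \<open>With a single column \<open>p\<close>, the nonzero entries at
      \<open>(a, b)\<close> and \<open>(b, a)\<close> make both factors of the entry at
      \<open>(a, a)\<close> nonzero, contradicting the absence of loops.\<close>
    then show ?thesis
      using fac[of a a] fac[of a b] fac[of b a] ab simple_graphD(1-3)[OF G ab] simple_graphD(4)[OF G]
      by (auto simp: graph_adj_def split: if_splits)
  qed
qed

lemma gain_rank_pos:
  assumes G: "simple_graph n E" and "unit_gain E \<phi>" and ab: "E a b"
  shows "gain_rank n E \<phi> > 0"
proof (rule ccontr)
  assume "\<not> gain_rank n E \<phi> > 0"
  moreover obtain S g where S: "S \<subseteq> {0..<n}" "card S = gain_rank n E \<phi>"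
    and fac: "\<And>i j. i < n \<Longrightarrow> j < n \<Longrightarrow>
      gain_adj n E \<phi> $$ (i, j) = (\<Sum>l\<in>S. gain_adj n E \<phi> $$ (i, l) * g l j)"
    using vec_space.rank_column_factorization[OF gain_adj_carrier] unfolding gain_rank_def by blast
  moreover have "finite S" using S(1) finite_subset by blast
  ultimately have "S = {}" by simp
  moreover have "cmod (\<phi> a b) = 1" using assms by (simp add: unit_gain_def)
  then have "\<phi> a b \<noteq> 0" by auto
  ultimately show False
    using fac[of a b] ab simple_graphD(1-3)[OF G ab] by (simp add: gain_adj_def)
qed

text \<open>The rows of \<open>a\<close> and \<open>b\<close> are independent, so in rank 2 they
  determine every entry. The two parts are the neighbourhoods of \<open>b\<close> and of
  \<open>a\<close>, and all vertices outside them are isolated.\<close>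

lemma complete_bipartite_of_graph_rank_2:
  assumes G: "simple_graph n E" and ab: "E a b" and r: "graph_rank n E = 2"
  shows "E x y \<longleftrightarrow> E b x \<and> E a y \<or> E a x \<and> E b y" and "\<not> (E a x \<and> E b x)"
proof -
  define A where "A = (\<lambda>i j. if E i j then 1 else (0 :: real))"
  obtain S g where S: "card S = 2" and S': "S \<subseteq> {0..<n}"
    and fac: "\<And>i j. i < n \<Longrightarrow> j < n \<Longrightarrow>
      graph_adj n E $$ (i, j) = (\<Sum>l\<in>S. graph_adj n E $$ (i, l) * g l j)"
    using vec_space.rank_column_factorization[OF graph_adj_carrier] r unfolding graph_rank_def by metis
  obtain p q where pq: "S = {p, q}" "p \<noteq> q" using S by (auto simp: card_2_iff)
  have fac2: "A i j = A i p * g p j + A i q * g q j" if "i < n" "j < n" for i j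
    using fac[OF that] that pq S' by (auto simp: graph_adj_def A_def)
  have lt: "a < n" "b < n" using simple_graphD(1-3)[OF G ab] by auto
  have vals: "A a a = 0" "A a b = 1" "A b a = 1" "A b b = 0"
    using ab simple_graphD[OF G] by (auto simp: A_def)
  have sym: "A i j = A j i" for i j using simple_graphD(3)[OF G] by (auto simp: A_def)
  \<comment> \<open>The 3x3 minor with rows a, b, i and columns a, b, j vanishes.\<close>
  have minor: "A i j = A i b * A a j + A i a * A b j" if ij: "i < n" "j < n" for i j
  proof -
    have "A i j * (A a a * A b b - A a b * A b a)
        - A i b * (A a a * A b j - A a j * A b a)
        + A i a * (A a b * A b j - A a j * A b b) = 0"
      unfolding fac2[OF ij] fac2[OF lt(1) lt(1)] fac2[OF lt(1) lt(2)] fac2[OF lt(2) lt(1)]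
        fac2[OF lt(2) lt(2)] fac2[OF ij(1) lt(1)] fac2[OF ij(1) lt(2)] fac2[OF lt(1) ij(2)] fac2[OF lt(2) ij(2)]
      by (simp add: algebra_simps)
    then show ?thesis by (simp add: vals)
  qed
  show no: "\<not> (E a x \<and> E b x)" for x
  proof
    assume *: "E a x \<and> E b x"
    then have "x < n" using simple_graphD[OF G] by blast
    \<comment> \<open>On the diagonal both terms coincide; a common neighbour of \<open>a\<close>
      and \<open>b\<close> would give \<open>A x x = 2\<close>.\<close>
    then have "A x x = 2 * (A a x * A b x)" using minor[of x x] sym[of x a] sym[of x b] by simp
    then show False using * simple_graphD(4)[OF G] by (simp add: A_def)
  qed
  show "E x y \<longleftrightarrow> E b x \<and> E a y \<or> E a x \<and> E b y"
  proof (cases "x < n \<and> y < n")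
    case True
    then have "A x y = A b x * A a y + A a x * A b y"
      using minor[of x y] sym[of x a] sym[of x b] by simp
    then show ?thesis using no[of x] by (auto simp: A_def split: if_splits)
  next
    case False
    then show ?thesis using simple_graphD(1,2)[OF G] by blast
  qed
qed

lemma gain_rank_le_of_cover:
  assumes T: "finite T" and "\<And>i j. E i j \<Longrightarrow> i \<in> T \<or> j \<in> T"
  shows "gain_rank n E \<phi> \<le> 2 * card T"
  unfolding gain_rank_def
  by (rule rank_le_of_vertex_cover[OF gain_adj_carrier T])
    (use assms in \<open>auto simp: gain_adj_def\<close>)

section \<open>Quadrangles with gains\<close>

lemma unit_gainD:
  assumes "unit_gain E \<phi>" "E i j"
  shows "cmod (\<phi> i j) = 1" "\<phi> j i = cnj (\<phi> i j)" "\<phi> i j * cnj (\<phi> i j) = 1" "cnj (\<phi> i j) * \<phi> i j = 1"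
proof -
  show 1: "cmod (\<phi> i j) = 1" "\<phi> j i = cnj (\<phi> i j)" using assms by (auto simp: unit_gain_def)
  show "\<phi> i j * cnj (\<phi> i j) = 1" using 1 by (simp add: complex_norm_square[symmetric])
  then show "cnj (\<phi> i j) * \<phi> i j = 1" by (simp add: mult.commute)
qed

text \<open>For length 4 the Type A value is \<open>(-1) ^ 2 = 1\<close>, so the cycle is balanced
  and can be switched to all gains 1 with an empty exceptional set.\<close>

lemma gain_rank_quadrangle_type_A:
  assumes gain: "unit_gain E \<phi>"
    and dist: "distinct [a, b, x, y]"
    and E: "\<And>i j. E i j \<longleftrightarrow> i \<in> {a, x} \<and> j \<in> {b, y} \<or> i \<in> {b, y} \<and> j \<in> {a, x}"
    and cyc: "\<phi> a b * \<phi> b x * \<phi> x y * \<phi> y a = 1"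
  shows "gain_rank n E \<phi> \<le> graph_rank n E"
proof -
  have es: "E a b" "E x b" "E x y" "E a y" by (auto simp: E)
  note u = unit_gainD[OF gain es(1)] unit_gainD[OF gain es(2)]
    unit_gainD[OF gain es(3)] unit_gainD[OF gain es(4)]
  \<comment> \<open>Normalised to 1 at \<open>a\<close>, \<open>d\<close> is forced by the edges
    \<open>ab\<close>, \<open>xb\<close> and \<open>ay\<close>; the cycle condition then settles
    \<open>xy\<close>. The value 1 elsewhere only keeps the modulus right.\<close>
  define d where "d = (\<lambda>i. if i = a then 1 else if i = b then cnj (\<phi> a b)
     else if i = x then \<phi> x b * cnj (\<phi> a b) else if i = y then cnj (\<phi> a y) else 1)"
  have d1: "cmod (d i) = 1" for i using u by (simp add: d_def norm_mult)
  have xy: "\<phi> x y = \<phi> x b * cnj (\<phi> a b) * \<phi> a y"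
  proof -
    have "\<phi> x b * cnj (\<phi> a b) * \<phi> a y = \<phi> x b * cnj (\<phi> a b) * \<phi> a y * (\<phi> a b * \<phi> b x * \<phi> x y * \<phi> y a)"
      using cyc by simp
    also have "\<dots> = (\<phi> x b * cnj (\<phi> x b)) * (\<phi> a b * cnj (\<phi> a b)) * (\<phi> a y * cnj (\<phi> a y)) * \<phi> x y"
      unfolding u(6) u(14) by (simp only: mult_ac)
    finally show ?thesis unfolding u(3) u(7) u(15) by simp
  qed
  have half: "\<phi> i j = d i * cnj (d j)" if ij: "i \<in> {a, x}" "j \<in> {b, y}" for i j
    using ij dist u xy by (auto simp: d_def mult.assoc)
  have "\<phi> i j = d i * cnj (d j)" if "E i j" for i j
  proof (cases "i \<in> {a, x} \<and> j \<in> {b, y}")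
    case True
    then show ?thesis using half by blast
  next
    case False
    then have ji: "j \<in> {a, x}" "i \<in> {b, y}" using that by (auto simp: E)
    then have "E j i" by (auto simp: E)
    then show ?thesis using half[OF ji] unit_gainD(2)[OF gain] by simp
  qed
  then show ?thesis
    using rank_bounds_of_switching_off_cover(1)[of d "{}" E \<phi> n] d1 by simp
qed

text \<open>In the vertex order \<open>a, x, b, y\<close> the matrix has zero diagonal blocks, and
  its other two blocks are a 2x2 matrix and its conjugate transpose. The block has determinant
  \<open>D\<close>, which vanishes only for cycle gain 1.\<close>

lemma gain_rank_quadrangle_type_B:
  assumes G: "simple_graph n E" and gain: "unit_gain E \<phi>"
    and dist: "distinct [a, b, x, y]"
    and E: "\<And>i j. E i j \<longleftrightarrow> i \<in> {a, x} \<and> j \<in> {b, y} \<or> i \<in> {b, y} \<and> j \<in> {a, x}"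
    and cyc: "\<phi> a b * \<phi> b x * \<phi> x y * \<phi> y a \<noteq> 1"
  shows "gain_rank n E \<phi> \<ge> 4"
proof -
  have es: "E a b" "E x b" "E x y" "E a y" by (auto simp: E)
  note u = unit_gainD[OF gain es(1)] unit_gainD[OF gain es(2)]
    unit_gainD[OF gain es(3)] unit_gainD[OF gain es(4)]
  define D where "D = \<phi> a b * \<phi> x y - \<phi> a y * \<phi> x b"
  have D: "D \<noteq> 0"
  proof
    assume "D = 0"
    then have "\<phi> a b * \<phi> x y = \<phi> a y * \<phi> x b" by (simp add: D_def)
    then have "\<phi> a b * \<phi> b x * \<phi> x y * \<phi> y a = (\<phi> a y * cnj (\<phi> a y)) * (\<phi> x b * cnj (\<phi> x b))"
      unfolding u(6) u(14) by (metis mult.assoc mult.commute)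
    then show False using cyc unfolding u(7) u(15) by simp
  qed
  define idx where "idx = (\<lambda>k::nat. [a, x, b, y] ! k)"
  have lt: "a < n" "b < n" "x < n" "y < n" using es simple_graphD[OF G] by blast+
  define B where "B = mat 4 4 (\<lambda>(i, j). gain_adj n E \<phi> $$ (idx i, idx j))"
  have lt4: "i < 4 \<Longrightarrow> i = 0 \<or> i = 1 \<or> i = 2 \<or> i = 3" for i :: nat by auto
  have idx: "i < 4 \<Longrightarrow> idx i < n" for i using lt4[of i] lt by (auto simp: idx_def)
  have B: "B \<in> carrier_mat 4 4" by (simp add: B_def)
  have "det B \<noteq> 0"
  proof
    assume "det B = 0"
    then obtain v where v: "v \<in> carrier_vec 4" "v \<noteq> 0\<^sub>v 4" "B *\<^sub>v v = 0\<^sub>v 4"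
      using det_0_iff_vec_prod_zero_field[OF B] by blast
    have row: "(\<Sum>j = 0..<4. B $$ (i, j) * v $ j) = 0" if "i < 4" for i
    proof -
      have "(B *\<^sub>v v) $ i = 0" using v(3) that by simp
      then show ?thesis using that B v(1) by (simp add: scalar_prod_def)
    qed
    have ne: "\<not> E a a" "\<not> E x x" "\<not> E a x" "\<not> E x a" "\<not> E b b" "\<not> E y y" "\<not> E b y" "\<not> E y b"
      using dist by (auto simp: E)
    have es': "E b a" "E b x" "E y x" "E y a" by (auto simp: E)
    note s = B_def idx_def gain_adj_def lt ne es es' eval_nat_numeral
    have r0: "\<phi> a b * v $ 2 + \<phi> a y * v $ 3 = 0"
      using row[of 0] by (simp add: s)
    have r1: "\<phi> x b * v $ 2 + \<phi> x y * v $ 3 = 0"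
      using row[of 1] by (simp add: s)
    have r2: "cnj (\<phi> a b) * v $ 0 + cnj (\<phi> x b) * v $ 1 = 0"
      using row[of 2] by (simp add: s u(2,6))
    have r3: "cnj (\<phi> a y) * v $ 0 + cnj (\<phi> x y) * v $ 1 = 0"
      using row[of 3] by (simp add: s u(10,14))
    \<comment> \<open>Cramer's rule for a homogeneous 2x2 system. The kernel equations decouple into
      one system with determinant \<open>D\<close> and one with \<open>cnj D\<close>, so the kernel
      is trivial.\<close>
    have cramer: "(p * q' - q * p') * s = 0 \<and> (p * q' - q * p') * t = 0"
      if "p * s + q * t = 0" "p' * s + q' * t = 0" for p q p' q' s t :: complex
    proof -
      have "(p * q' - q * p') * s = q' * (p * s + q * t) - q * (p' * s + q' * t)"
        "(p * q' - q * p') * t = p * (p' * s + q' * t) - p' * (p * s + q * t)"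
        by (simp_all add: algebra_simps)
      then show ?thesis using that by simp
    qed
    have "D * v $ 2 = 0" "D * v $ 3 = 0"
      using cramer[OF r0 r1] by (simp_all add: D_def)
    moreover have "cnj D * v $ 0 = 0" "cnj D * v $ 1 = 0"
      using cramer[OF r2 r3] by (simp_all add: D_def mult.commute)
    ultimately have "v $ 0 = 0" "v $ 1 = 0" "v $ 2 = 0" "v $ 3 = 0" using D by auto
    then have "v = 0\<^sub>v 4" using v(1) by (intro eq_vecI) (auto dest!: lt4)
    then show False using v(2) by simp
  qed
  then show ?thesis
    unfolding gain_rank_def
    by (intro rank_ge_of_nonsingular_submatrix[OF gain_adj_carrier B, where r = idx and c = idx] idx)
      (auto simp: B_def)
qed

lemma cycle_gain_4:
  "cycle_gain \<phi> [a, b, x, y] = \<phi> a b * \<phi> b x * \<phi> x y * \<phi> y a"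
proof -
  have len: "length [a, b, x, y] = 4" by simp
  have set4: "{..<4} = {0, 1, 2, 3::nat}" by auto
  show ?thesis unfolding cycle_gain_def len set4 by (simp add: mult.assoc)
qed

text \<open>Opposite vertices of a quadrangle form the parts of a complete bipartite graph, so the
  list encoding turns into the form that the rank lemmas use; the sign in \<open>typeB\<close>
  becomes \<open>(-1) ^ 2 = 1\<close>.\<close>

lemma C4_typeB_plus_isolated_iff:
  "C4_typeB_plus_isolated E \<phi> \<longleftrightarrow> (\<exists>a b x y. distinct [a, b, x, y] \<and>
     (\<forall>i j. E i j \<longleftrightarrow> i \<in> {a, x} \<and> j \<in> {b, y} \<or> i \<in> {b, y} \<and> j \<in> {a, x}) \<and>
     \<phi> a b * \<phi> b x * \<phi> x y * \<phi> y a \<noteq> 1)"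
proof -
  have ex4: "(\<exists>k<4. P k) \<longleftrightarrow> P 0 \<or> P 1 \<or> P 2 \<or> P (3::nat)" for P
    by (auto simp: less_Suc_eq eval_nat_numeral)
  have all4: "(\<forall>k<4. P k) \<longleftrightarrow> P 0 \<and> P 1 \<and> P 2 \<and> P (3::nat)" for P
    by (auto simp: less_Suc_eq eval_nat_numeral)
  have edges: "(\<exists>k<4. {i, j} = {[a, b, x, y] ! k, [a, b, x, y] ! ((k + 1) mod 4)}) \<longleftrightarrow>
      i \<in> {a, x} \<and> j \<in> {b, y} \<or> i \<in> {b, y} \<and> j \<in> {a, x}" for a b x y i j :: nat
    unfolding ex4 by (auto simp: doubleton_eq_iff)
  have cyc: "is_cycle E [a, b, x, y] \<longleftrightarrow> distinct [a, b, x, y] \<and> E a b \<and> E b x \<and> E x y \<and> E y a" for a b x y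
  proof -
    have len: "length [a, b, x, y] = 4" by simp
    show ?thesis unfolding is_cycle_def len all4 by simp
  qed
  have len4: "length vs = 4 \<longleftrightarrow> (\<exists>a b x y. vs = [a, b, x, y])" for vs :: "nat list"
    by (auto simp: length_Suc_conv eval_nat_numeral)
  show ?thesis
    unfolding C4_typeB_plus_isolated_def
  proof (intro iffI; elim exE conjE)
    fix vs assume *: "length vs = 4" "is_cycle E vs" "typeB \<phi> vs"
      "\<forall>i j. E i j \<longleftrightarrow> (\<exists>k<4. {i, j} = {vs ! k, vs ! ((k + 1) mod 4)})"
    then obtain a b x y where vs: "vs = [a, b, x, y]" using len4 by blast
    show "\<exists>a b x y. distinct [a, b, x, y] \<and>
     (\<forall>i j. E i j \<longleftrightarrow> i \<in> {a, x} \<and> j \<in> {b, y} \<or> i \<in> {b, y} \<and> j \<in> {a, x}) \<and>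
     \<phi> a b * \<phi> b x * \<phi> x y * \<phi> y a \<noteq> 1"
      using * unfolding vs edges cyc typeB_def cycle_gain_4
      by (intro exI[of _ a] exI[of _ b] exI[of _ x] exI[of _ y]) simp
  next
    fix a b x y assume *: "distinct [a, b, x, y]"
      "\<forall>i j. E i j \<longleftrightarrow> i \<in> {a, x} \<and> j \<in> {b, y} \<or> i \<in> {b, y} \<and> j \<in> {a, x}"
      "\<phi> a b * \<phi> b x * \<phi> x y * \<phi> y a \<noteq> 1"
    then show "\<exists>vs. length vs = 4 \<and> is_cycle E vs \<and> typeB \<phi> vs \<and>
        (\<forall>i j. E i j \<longleftrightarrow> (\<exists>k<4. {i, j} = {vs ! k, vs ! ((k + 1) mod 4)}))"
      by (intro exI[of _ "[a, b, x, y]"] conjI)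
        (unfold edges cyc typeB_def cycle_gain_4, auto)
  qed
qed

text \<open>The gain rank is at least 4 by the Type B lemma and at most \<open>2 + 2 * 1\<close> by
  the general rank difference bound.\<close>

lemma C4_typeB_ranks:
  assumes G: "simple_graph n E" and gain: "unit_gain E \<phi>" and C4: "C4_typeB_plus_isolated E \<phi>"
  shows "theta n E = 1" "graph_rank n E = 2" "gain_rank n E \<phi> = 4"
proof -
  obtain a b x y where dist: "distinct [a, b, x, y]"
    and E: "\<And>i j. E i j \<longleftrightarrow> i \<in> {a, x} \<and> j \<in> {b, y} \<or> i \<in> {b, y} \<and> j \<in> {a, x}"
    and cyc: "\<phi> a b * \<phi> b x * \<phi> x y * \<phi> y a \<noteq> 1"
    using C4 unfolding C4_typeB_plus_isolated_iff by blast
  have es: "E a b" "E x y" by (auto simp: E)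
  have lt: "a < n" "b < n" "x < n" "y < n" using es simple_graphD[OF G] by blast+
  show theta: "theta n E = 1"
    using dist lt by (subst theta_complete_bipartite[of "{a, x}" n "{b, y}"]) (auto simp: E)
  show rG: "graph_rank n E = 2"
  proof (rule antisym)
    show "2 \<le> graph_rank n E" using graph_rank_ge_2[OF G es(1)] .
    \<comment> \<open>Two products of indicators suffice, one for each direction between the parts
      \<open>{a, x}\<close> and \<open>{b, y}\<close>; the booleans index them.\<close>
    have "graph_rank n E \<le> card (UNIV :: bool set)"
      unfolding graph_rank_def
      by (rule vec_space.rank_le_card_of_sum_products[OF _ graph_adj_carrier,
            where f = "\<lambda>i l. of_bool (i \<in> (if l then {a, x} else {b, y}))"
              and g = "\<lambda>l j. of_bool (j \<in> (if l then {b, y} else {a, x}))"])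
        (use dist in \<open>auto simp: graph_adj_def E UNIV_bool\<close>)
    then show "graph_rank n E \<le> 2" by simp
  qed
  show "gain_rank n E \<phi> = 4"
    using gain_rank_quadrangle_type_B[OF G gain dist E cyc] rank_difference_le_theta(1)[OF G gain] theta rG
    by simp
qed

text \<open>Covering the edges by either part bounds \<open>theta\<close> by that part's size minus
  1. As \<open>theta\<close> is the product of these two positive numbers, both equal 1.\<close>

lemma C4_typeB_of_extremal_ranks:
  assumes G: "simple_graph n E" and gain: "unit_gain E \<phi>" and ab: "E a b"
    and rG: "graph_rank n E = 2" and r: "int (gain_rank n E \<phi>) = 2 + 2 * theta n E"
    and pos: "theta n E > 0"
  shows "C4_typeB_plus_isolated E \<phi>"
proof -
  define X where "X = {x. E b x}"
  define Y where "Y = {x. E a x}"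
  have E: "E i j \<longleftrightarrow> i \<in> X \<and> j \<in> Y \<or> i \<in> Y \<and> j \<in> X" for i j
    using complete_bipartite_of_graph_rank_2(1)[OF G ab rG, of i j] by (auto simp: X_def Y_def)
  have disj: "X \<inter> Y = {}"
    using complete_bipartite_of_graph_rank_2(2)[OF G ab rG] by (auto simp: X_def Y_def)
  have aX: "a \<in> X" and bY: "b \<in> Y" using ab simple_graphD(3)[OF G ab] by (auto simp: X_def Y_def)
  have sub: "X \<subseteq> {0..<n}" "Y \<subseteq> {0..<n}" using simple_graphD(2)[OF G] by (auto simp: X_def Y_def)
  have fin: "finite X" "finite Y" using sub by (auto intro: finite_subset)
  have theta: "theta n E = (int (card X) - 1) * (int (card Y) - 1)"
    by (rule theta_complete_bipartite[OF sub disj]) (use aX bY E in auto)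
  have "gain_rank n E \<phi> \<le> 2 * card X" "gain_rank n E \<phi> \<le> 2 * card Y"
    by (rule gain_rank_le_of_cover; use fin E in auto)+
  then have le: "theta n E \<le> int (card X) - 1" "theta n E \<le> int (card Y) - 1" using r by linarith+
  have ge: "int (card X) - 1 > 0" "int (card Y) - 1 > 0" using le pos by linarith+
  \<comment> \<open>Cancelling the positive factor \<open>int (card X) - 1\<close> leaves
    \<open>card Y \<le> 2\<close>; positivity of the other factor gives equality.\<close>
  have "(int (card X) - 1) * (int (card Y) - 1) \<le> (int (card X) - 1) * 1" using le theta by simp
  then have "card Y = 2" using ge unfolding mult_le_cancel_left_pos[OF ge(1)] by linarith
  moreover have "(int (card Y) - 1) * (int (card X) - 1) \<le> (int (card Y) - 1) * 1"
    using le theta by (simp add: mult.commute)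
  then have "card X = 2" using ge unfolding mult_le_cancel_left_pos[OF ge(2)] by linarith
  ultimately obtain x y where XY: "X = {a, x}" "Y = {b, y}" "x \<noteq> a" "y \<noteq> b"
    using aX bY by (auto simp: card_2_iff)
  have dist: "distinct [a, b, x, y]" using XY disj by auto
  have E': "E i j \<longleftrightarrow> i \<in> {a, x} \<and> j \<in> {b, y} \<or> i \<in> {b, y} \<and> j \<in> {a, x}" for i j
    using E[of i j] XY by simp
  \<comment> \<open>A cycle gain of 1 would force the gain rank down to
    \<open>graph_rank n E = 2\<close>, below \<open>2 + 2 * theta n E\<close>.\<close>
  have "\<phi> a b * \<phi> b x * \<phi> x y * \<phi> y a \<noteq> 1"
    using gain_rank_quadrangle_type_A[OF gain dist E', of n] r rG pos by fastforce
  then show ?thesis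
    unfolding C4_typeB_plus_isolated_iff using dist E' by blast
qed

section \<open>The two bounds and their equality cases\<close>

theorem theorem4p10:
  fixes n :: nat and E :: "nat \<Rightarrow> nat \<Rightarrow> bool" and \<phi> :: "nat \<Rightarrow> nat \<Rightarrow> complex"
  assumes "simple_graph n E" and "unit_gain E \<phi>"
    and "\<exists>i j. E i j"
  shows "1 - real_of_int (theta n E) \<le> real (gain_rank n E \<phi>) / real (graph_rank n E) \<and>
         real (gain_rank n E \<phi>) / real (graph_rank n E) \<le> 1 + real_of_int (theta n E) \<and>
         (real (gain_rank n E \<phi>) / real (graph_rank n E) = 1 + real_of_int (theta n E) \<longleftrightarrow>
            acyclic_graph E \<or> C4_typeB_plus_isolated E \<phi>) \<and>
         (real (gain_rank n E \<phi>) / real (graph_rank n E) = 1 - real_of_int (theta n E) \<longleftrightarrow>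
            acyclic_graph E)"
proof -
  obtain a b where ab: "E a b" using assms(3) by blast
  define r g t where "r = int (gain_rank n E \<phi>)" and "g = int (graph_rank n E)" and "t = theta n E"
  have g2: "g \<ge> 2" using graph_rank_ge_2[OF assms(1) ab] by (simp add: g_def)
  have r0: "r > 0" using gain_rank_pos[OF assms(1,2) ab] by (simp add: r_def)
  have t0: "t \<ge> 0" and ac: "acyclic_graph E \<longleftrightarrow> t = 0"
    using theta_nonneg_and_zero_iff_acyclic[OF assms(1)] by (auto simp: t_def)
  have ub: "r \<le> g + 2 * t" and lb: "g \<le> r + 2 * t"
    using rank_difference_le_theta[OF assms(1,2)] by (auto simp: r_def g_def t_def)
  have C4: "C4_typeB_plus_isolated E \<phi> \<longleftrightarrow> g = 2 \<and> r = 2 + 2 * t \<and> t > 0"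
    using C4_typeB_ranks[OF assms(1,2)] C4_typeB_of_extremal_ranks[OF assms(1,2) ab]
    by (auto simp: r_def g_def t_def)
  \<comment> \<open>As \<open>g\<close> is at least 2, the additive error \<open>2 * t\<close> is at
    most \<open>g * t\<close>, which is what division by \<open>g\<close> requires.\<close>
  have gt: "2 * t \<le> g * t" using g2 t0 by (simp add: mult_right_mono)
  have gt_eq: "g * t = 2 * t \<longleftrightarrow> g = 2 \<or> t = 0" by auto
  have q: "real (gain_rank n E \<phi>) / real (graph_rank n E) = real_of_int r / real_of_int g"
    by (simp add: r_def g_def)
  have g0: "real_of_int g > 0" using g2 by simp
  have "real_of_int (g * (1 - t)) \<le> real_of_int r" unfolding of_int_le_iff
    using lb gt by (simp add: algebra_simps)
  then have 1: "1 - real_of_int t \<le> real_of_int r / real_of_int g"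
    using g0 by (simp add: field_simps)
  have "real_of_int r \<le> real_of_int (g * (1 + t))" unfolding of_int_le_iff
    using ub gt by (simp add: algebra_simps)
  then have 2: "real_of_int r / real_of_int g \<le> 1 + real_of_int t"
    using g0 by (simp add: field_simps)
  have "real_of_int r / real_of_int g = 1 + real_of_int t \<longleftrightarrow> real_of_int r = real_of_int (g * (1 + t))"
    using g0 by (simp add: field_simps)
  also have "\<dots> \<longleftrightarrow> r = g + g * t" unfolding of_int_eq_iff by (simp add: algebra_simps)
  \<comment> \<open>Equality forces \<open>g * t \<le> 2 * t\<close> through \<open>ub\<close>,
    hence \<open>g * t = 2 * t\<close>, so that \<open>t = 0\<close> or \<open>g = 2\<close>.
    Conversely, for \<open>t = 0\<close> the bounds \<open>ub\<close> and \<open>lb\<close> give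
    \<open>r = g\<close>.\<close>
  also have "\<dots> \<longleftrightarrow> t = 0 \<or> (g = 2 \<and> r = 2 + 2 * t \<and> t > 0)"
    using ub lb gt gt_eq t0 by auto
  finally have 3: "real_of_int r / real_of_int g = 1 + real_of_int t \<longleftrightarrow>
      acyclic_graph E \<or> C4_typeB_plus_isolated E \<phi>" using ac C4 by simp
  have "real_of_int r / real_of_int g = 1 - real_of_int t \<longleftrightarrow> real_of_int r = real_of_int (g * (1 - t))"
    using g0 by (auto simp: field_simps)
  also have "\<dots> \<longleftrightarrow> r = g - g * t" unfolding of_int_eq_iff by (simp add: algebra_simps)
  \<comment> \<open>For \<open>t > 0\<close>, \<open>lb\<close> would again force
    \<open>g = 2\<close>, hence \<open>r = 2 - 2 * t \<le> 0\<close>, contradicting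
    \<open>r0\<close>.\<close>
  also have "\<dots> \<longleftrightarrow> t = 0"
    using ub lb gt gt_eq t0 r0 by auto
  finally have 4: "real_of_int r / real_of_int g = 1 - real_of_int t \<longleftrightarrow> acyclic_graph E"
    using ac by simp
  show ?thesis unfolding q t_def[symmetric] using 1 2 3 4 by blast
qed

end
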